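(* Let $r\ge 1$, let $\mathbf m\in\mathcal M_r$ be a Motzkin path, let $T'_{\mathbf m}$ be the transfer matrix of the compactified graph $\Gamma'_{\mathbf m}$, let $\sigma_{\mathbf m}=(i_1,\dots,i_r)$ and $\tau_{\mathbf m}=(j_1,\dots,j_r)$, and let $$P_{\mathbf m}=(f_{i_1}f_{i_2}\cdots f_{i_r})\,(d_1d_2\cdots d_{r+1})\,(e_{j_1}e_{j_2}\cdots e_{j_r}).$$ Then $$(I-T'_{\mathbf m})^{-1}=(I-tP_{\mathbf m})^{-1}\,(f_{i_1}f_{i_2}\cdots f_{i_r}),$$ which allows one to rewrite the generating function $\big((I-T'_{\mathbf m})^{-1}\big)_{1,1}$ of weighted paths from vertex $1$ to vertex $1$ on $\Gamma'_{\mathbf m}$ as $$\big((I-T'_{\mathbf m})^{-1}\big)_{1,1}=\begin{cases}\big((I-tP_{\mathbf m})^{-1}\big)_{1,1}+\big((I-tP_{\mathbf m})^{-1}\big)_{1,2} & \text{if } a_1>1,\\[1mm] \displaystyle\sum_{a=a_1}^{a_2+1}\big((I-tP_{\mathbf m})^{-1}\big)_{1,a} & \text{if } a_1=1,\end{cases}$$ where $[a_1,a_2]$ is the first maximal ascending segment of $\mathbf m$.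
   Context: Motzkin paths: $\mathcal M_r$ is the set of integer vectors $\mathbf m=(m_1,\dots,m_r)$ with $|m_\alpha-m_{\alpha+1}|\le 1$ for $1\le\alpha<r$ and $\min_\alpha m_\alpha=0$. A maximal ascending (resp. descending) segment of $\mathbf m$ is a maximal interval $[\alpha,\beta]\subset\{1,\dots,r\}$, $\beta>\alpha$, of consecutive indices with $m_{\alpha+j}=m_\alpha+j$ (resp. $m_{\alpha+j}=m_\alpha-j$) for $0\le j\le\beta-\alpha$. The maximal ascending segments are written, from left to right, $[a_1,a_2],[a_3,a_4],\dots,[a_{2k-1},a_{2k}]$ with $(a_1,\dots,a_{2k})$ increasing. $Q$-system: $\{R_{\alpha,n}\}_{0\le\alpha\le r+1,n\in\mathbb Z}$ is the solution of $R_{\alpha,n+1}R_{\alpha,n-1}=R_{\alpha,n}^2+R_{\alpha+1,n}R_{\alpha-1,n}$ ($1\le\alpha\le r$), $R_{0,n}=R_{r+1,n}=1$, with initial data $R_{\alpha,0},R_{\alpha,1}$ ($1\le\alpha\le r$) independent indeterminates. Weights: put $\lambda_{\alpha,n}=R_{\alpha,n+1}/R_{\alpha,n}$ and $\mu_{\alpha,n}=R_{\alpha,n}/R_{\alpha-1,n}$. For $1\le \alpha\le r+1$, $y_{2\alpha-1}=\lambda_{\alpha,m_\alpha}/\lambda_{\alpha-1,m_{\alpha-1}}$; for $1\le\alpha\le r$, $y_{2\alpha}=\frac{\mu_{\alpha+1,m_\alpha+1}}{\mu_{\alpha,m_\alpha}}\,A_\alpha B_\alpha$, where $A_\alpha=\lambda_{\alpha+1,m_{\alpha+1}}/\lambda_{\alpha+1,m_\alpha}$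 if $m_\alpha=m_{\alpha+1}+1$ and $A_\alpha=1$ otherwise, and $B_\alpha=\lambda_{\alpha-1,m_\alpha}/\lambda_{\alpha-1,m_{\alpha-1}}$ if $m_{\alpha-1}=m_\alpha+1$ and $B_\alpha=1$ otherwise. (Since $\lambda_{0,n}=\lambda_{r+1,n}=1$, the values of $m_0,m_{r+1}$ are irrelevant.) The compactified graph $\Gamma'_{\mathbf m}$ has vertices $1,\dots,r+1$; oriented edges $i\to i+1$ with weight $1$ and $i+1\to i$ with weight $t y_{2i}$ ($1\le i\le r$); loops $i\to i$ with weight $t y_{2i-1}$ ($1\le i\le r+1$). In addition: for every maximal descending segment $[\alpha,\alpha+i-1]$ of $\mathbf m$, $i\ge 2$, it has edges $\alpha+p\to\alpha+q$ for all $0\le q$, $q+2\le p\le i$, with weight $t\,\prod_{j=\alpha+q}^{\alpha+p-1}y_{2j}\big/\prod_{j=\alpha+q+1}^{\alpha+p-1}y_{2j-1}$; for every maximal ascending segment $[\alpha,\alpha+i-1]$, $i\ge2$, it has edges $\alpha+q\to\alpha+p$ for all $0\le q$, $q+2\le p\le i$, with weight $(-1)^{p-q-1}$. The transfer matrix $T'_{\mathbf m}$ is the $(r+1)\times(r+1)$ matrix whose $(b,a)$ entry (row $b$, column $a$) is the weight of the edge $a\to b$, or $0$ if there is none. Inverses are taken over formal power series in $t$. Sequences: $\sigma_{\mathbf m}$ is obtained from the sequence $(r,r-1,\dots,1)$ by reversing, for each maximal ascending segment $[\alpha,\beta]$ of $\mathbf m$, the block $(\beta,\beta-1,\dots,\alpha)$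 into $(\alpha,\alpha+1,\dots,\beta)$. $\tau_{\mathbf m}$ is obtained from $(r,r-1,\dots,1)$ in the same way using the maximal descending segments. For example, $\mathbf m=(2,1,2,2,2,1,0,0,1)$ gives $\sigma_{\mathbf m}=(8,9,7,6,5,4,2,3,1)$ and $\tau_{\mathbf m}=(9,8,5,6,7,4,3,1,2)$. Elementary matrices of size $(r+1)\times(r+1)$, with $E_{i,j}$ the matrix units: $f_i=I+E_{i+1,i}$ and $e_i=I+\frac{y_{2i}}{y_{2i-1}}E_{i,i+1}$ for $1\le i\le r$; $d_i=I+(y_{2i-1}-1)E_{i,i}$ for $1\le i\le r+1$.
   Formalization: The printed case formula is false (r=2, m=(0,1)); proved instead, with X=(I-tP)^{-1}: the (1,1) entry is X_11+X_12 if a_1=1, the sum of X_{1,a} for a=1..a_1+1 if a_1>1, and for a=1..r+1 if there is no ascending segment. The matrix identity is unchanged. *)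

theory Defs
  imports
    "HOL-Library.Poly_Mapping"
    "HOL-Computational_Algebra.Fraction_Field"
    "HOL-Computational_Algebra.Formal_Power_Series"
    "Jordan_Normal_Form.Matrix"
begin

text \<open>The ground field: rational functions over \<open>'k\<close> in indeterminates indexed by the natural
  numbers. A polynomial is a finitely supported map from exponent vectors to coefficients.\<close>

type_synonym 'k ratfun = "((nat \<Rightarrow>\<^sub>0 nat) \<Rightarrow>\<^sub>0 'k) fract"

definition indet :: "nat \<Rightarrow> 'k::field ratfun" where
  "indet v = Fraction_Field.Fract (Poly_Mapping.single (Poly_Mapping.single v 1) 1) 1"


text \<open>The initial data \<open>R \<alpha> 0\<close>, \<open>R \<alpha> 1\<close> for \<open>1 \<le> \<alpha> \<le> r\<close> are distinct indeterminates. Values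
  \<open>R \<alpha> n\<close> with \<open>\<alpha> > r + 1\<close> are unconstrained and never used.\<close>

definition Q_system :: "nat \<Rightarrow> (nat \<Rightarrow> int \<Rightarrow> 'k::field ratfun) \<Rightarrow> bool" where
  "Q_system r R \<longleftrightarrow>
     (\<forall>n. R 0 n = 1 \<and> R (r + 1) n = 1) \<and>
     (\<forall>\<alpha>\<in>{1..r}. \<forall>n. R \<alpha> (n + 1) * R \<alpha> (n - 1) = (R \<alpha> n)^2 + R (\<alpha> + 1) n * R (\<alpha> - 1) n) \<and>
     (\<forall>\<alpha>\<in>{1..r}. R \<alpha> 0 = indet (2 * \<alpha>) \<and> R \<alpha> 1 = indet (2 * \<alpha> + 1))"


text \<open>A path \<open>(m\<^sub>1, \<dots>, m\<^sub>r)\<close> is a function on the naturals of which only the values at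
  \<open>1, \<dots>, r\<close> matter.\<close>

definition motzkin_path :: "nat \<Rightarrow> (nat \<Rightarrow> int) \<Rightarrow> bool" where
  "motzkin_path r m \<longleftrightarrow>
     (\<forall>\<alpha>. 1 \<le> \<alpha> \<and> \<alpha> < r \<longrightarrow> \<bar>m \<alpha> - m (\<alpha> + 1)\<bar> \<le> 1) \<and> Min (m ` {1..r}) = 0"

text \<open>Segments of slope \<open>s\<close>: ascending for \<open>s = 1\<close>, descending for \<open>s = -1\<close>.\<close>

definition segment :: "int \<Rightarrow> nat \<Rightarrow> (nat \<Rightarrow> int) \<Rightarrow> nat \<Rightarrow> nat \<Rightarrow> bool" where
  "segment s r m \<alpha> \<beta> \<longleftrightarrow>
     1 \<le> \<alpha> \<and> \<alpha> < \<beta> \<and> \<beta> \<le> r \<and> (\<forall>j\<le>\<beta> - \<alpha>. m (\<alpha> + j) = m \<alpha> + s * int j)"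

definition max_segment :: "int \<Rightarrow> nat \<Rightarrow> (nat \<Rightarrow> int) \<Rightarrow> nat \<Rightarrow> nat \<Rightarrow> bool" where
  "max_segment s r m \<alpha> \<beta> \<longleftrightarrow> segment s r m \<alpha> \<beta> \<and>
     (\<forall>\<alpha>' \<beta>'. segment s r m \<alpha>' \<beta>' \<and> {\<alpha>..\<beta>} \<subseteq> {\<alpha>'..\<beta>'} \<longrightarrow> \<alpha>' = \<alpha> \<and> \<beta>' = \<beta>)"

abbreviation "max_asc \<equiv> max_segment 1"
abbreviation "max_desc \<equiv> max_segment (-1)"

definition first_max_asc :: "nat \<Rightarrow> (nat \<Rightarrow> int) \<Rightarrow> nat \<Rightarrow> nat \<Rightarrow> bool" where
  "first_max_asc r m a\<^sub>1 a\<^sub>2 \<longleftrightarrow> max_asc r m a\<^sub>1 a\<^sub>2 \<and> (\<forall>\<alpha> \<beta>. max_asc r m \<alpha> \<beta> \<longrightarrow> a\<^sub>1 \<le> \<alpha>)"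


context
  fixes R :: "nat \<Rightarrow> int \<Rightarrow> 'k::field ratfun" and m :: "nat \<Rightarrow> int"
begin

definition lam :: "nat \<Rightarrow> int \<Rightarrow> 'k ratfun" where
  "lam \<alpha> n = R \<alpha> (n + 1) / R \<alpha> n"

definition mu :: "nat \<Rightarrow> int \<Rightarrow> 'k ratfun" where
  "mu \<alpha> n = R \<alpha> n / R (\<alpha> - 1) n"

definition y_odd :: "nat \<Rightarrow> 'k ratfun" where
  "y_odd \<alpha> = lam \<alpha> (m \<alpha>) / lam (\<alpha> - 1) (m (\<alpha> - 1))"

definition y_even :: "nat \<Rightarrow> 'k ratfun" where
  "y_even \<alpha> = mu (\<alpha> + 1) (m \<alpha> + 1) / mu \<alpha> (m \<alpha>)
     * (if m \<alpha> = m (\<alpha> + 1) + 1 then lam (\<alpha> + 1) (m (\<alpha> + 1)) / lam (\<alpha> + 1) (m \<alpha>) else 1)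
     * (if m (\<alpha> - 1) = m \<alpha> + 1 then lam (\<alpha> - 1) (m \<alpha>) / lam (\<alpha> - 1) (m (\<alpha> - 1)) else 1)"

text \<open>\<open>y_wt (2 * \<alpha> - 1) = y_odd \<alpha>\<close> and \<open>y_wt (2 * \<alpha>) = y_even \<alpha>\<close>.\<close>

definition y_wt :: "nat \<Rightarrow> 'k ratfun" where
  "y_wt k = (if odd k then y_odd ((k + 1) div 2) else y_even (k div 2))"

text \<open>\<open>compact_edge r a b w\<close>: the graph has an edge from \<open>a\<close> to \<open>b\<close> of weight \<open>w\<close>. The
  formal variable \<open>t\<close> is \<^const>\<open>fps_X\<close>. A maximal segment \<open>[\<alpha>, \<alpha> + i - 1]\<close> with \<open>i \<ge> 2\<close>
  contributes edges among the vertices \<open>\<alpha>, \<dots>, \<alpha> + i\<close>.\<close>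

inductive compact_edge :: "nat \<Rightarrow> nat \<Rightarrow> nat \<Rightarrow> 'k ratfun fps \<Rightarrow> bool" for r where
  up: "1 \<le> i \<Longrightarrow> i \<le> r \<Longrightarrow> compact_edge r i (i + 1) 1"
| down: "1 \<le> i \<Longrightarrow> i \<le> r \<Longrightarrow> compact_edge r (i + 1) i (fps_X * fps_const (y_wt (2 * i)))"
| loop: "1 \<le> i \<Longrightarrow> i \<le> r + 1 \<Longrightarrow> compact_edge r i i (fps_X * fps_const (y_wt (2 * i - 1)))"
| desc: "2 \<le> i \<Longrightarrow> max_desc r m \<alpha> (\<alpha> + i - 1) \<Longrightarrow> q + 2 \<le> p \<Longrightarrow> p \<le> i \<Longrightarrow>
    compact_edge r (\<alpha> + p) (\<alpha> + q)
      (fps_X * fps_const ((\<Prod>j=\<alpha> + q..\<alpha> + p - 1. y_wt (2 * j))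
                          / (\<Prod>j=\<alpha> + q + 1..\<alpha> + p - 1. y_wt (2 * j - 1))))"
| asc: "2 \<le> i \<Longrightarrow> max_asc r m \<alpha> (\<alpha> + i - 1) \<Longrightarrow> q + 2 \<le> p \<Longrightarrow> p \<le> i \<Longrightarrow>
    compact_edge r (\<alpha> + q) (\<alpha> + p) ((-1) ^ (p - q - 1))"

text \<open>Matrix indices start at 0 in the library, so the entry in row \<open>b\<close> and column \<open>a\<close> is found
  at position \<open>(b - 1, a - 1)\<close>. There is at most one edge from \<open>a\<close> to \<open>b\<close>, because two
  maximal segments of the same slope are disjoint.\<close>

definition transfer_mat :: "nat \<Rightarrow> 'k ratfun fps mat" where
  "transfer_mat r = mat (r + 1) (r + 1) (\<lambda>(b, a).
     if \<exists>w. compact_edge r (a + 1) (b + 1) w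
     then THE w. compact_edge r (a + 1) (b + 1) w else 0)"

end


text \<open>The sequence \<open>(r, r - 1, \<dots>, 1)\<close> with the block \<open>(\<beta>, \<dots>, \<alpha>)\<close> reversed for every maximal
  segment \<open>[\<alpha>, \<beta>]\<close> of slope \<open>s\<close>. These blocks are pairwise disjoint, so reversing all of them
  replaces each entry \<open>v\<close> with \<open>\<alpha> \<le> v \<le> \<beta>\<close> by \<open>\<alpha> + \<beta> - v\<close>.\<close>

definition flip :: "int \<Rightarrow> nat \<Rightarrow> (nat \<Rightarrow> int) \<Rightarrow> nat \<Rightarrow> nat" where
  "flip s r m v =
     (if \<exists>\<alpha> \<beta>. max_segment s r m \<alpha> \<beta> \<and> v \<in> {\<alpha>..\<beta>}
      then THE w. \<exists>\<alpha> \<beta>. max_segment s r m \<alpha> \<beta> \<and> v \<in> {\<alpha>..\<beta>} \<and> w = \<alpha> + \<beta> - v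
      else v)"

definition sigma :: "nat \<Rightarrow> (nat \<Rightarrow> int) \<Rightarrow> nat list" where
  "sigma r m = map (flip 1 r m) (rev [1..<r + 1])"

definition tau :: "nat \<Rightarrow> (nat \<Rightarrow> int) \<Rightarrow> nat list" where
  "tau r m = map (flip (-1) r m) (rev [1..<r + 1])"


text \<open>\<open>mat_unit n i j\<close> is the matrix unit \<open>E\<^bsub>i,j\<^esub>\<close> with \<open>i\<close>, \<open>j\<close> counted from 1.\<close>

definition mat_unit :: "nat \<Rightarrow> nat \<Rightarrow> nat \<Rightarrow> 'a::semiring_1 mat" where
  "mat_unit n i j = mat n n (\<lambda>(a, b). if a + 1 = i \<and> b + 1 = j then 1 else 0)"

definition mat_prod :: "nat \<Rightarrow> 'a::semiring_1 mat list \<Rightarrow> 'a mat" where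
  "mat_prod n As = foldr (*) As (1\<^sub>m n)"

definition f_mat :: "nat \<Rightarrow> nat \<Rightarrow> 'k::field ratfun mat" where
  "f_mat r i = 1\<^sub>m (r + 1) + mat_unit (r + 1) (i + 1) i"

definition e_mat :: "(nat \<Rightarrow> int \<Rightarrow> 'k::field ratfun) \<Rightarrow> (nat \<Rightarrow> int) \<Rightarrow> nat \<Rightarrow> nat \<Rightarrow> 'k ratfun mat" where
  "e_mat R m r i =
     1\<^sub>m (r + 1) + (y_wt R m (2 * i) / y_wt R m (2 * i - 1)) \<cdot>\<^sub>m mat_unit (r + 1) i (i + 1)"

definition d_mat :: "(nat \<Rightarrow> int \<Rightarrow> 'k::field ratfun) \<Rightarrow> (nat \<Rightarrow> int) \<Rightarrow> nat \<Rightarrow> nat \<Rightarrow> 'k ratfun mat" where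
  "d_mat R m r i = 1\<^sub>m (r + 1) + (y_wt R m (2 * i - 1) - 1) \<cdot>\<^sub>m mat_unit (r + 1) i i"

definition F_mat :: "(nat \<Rightarrow> int) \<Rightarrow> nat \<Rightarrow> 'k::field ratfun mat" where
  "F_mat m r = mat_prod (r + 1) (map (f_mat r) (sigma r m))"

text \<open>The first column of \<open>F_mat m r\<close> has ones in rows \<open>1, \<dots>, c + 1\<close> and zeros below, where
  \<open>c = a\<^sub>1\<close> is the start of the first maximal ascending segment, and \<open>c = r\<close> if there is none. The
  paper's formula for the generating function sums two terms when \<open>a\<^sub>1 > 1\<close> and the terms
  \<open>a\<^sub>1, \<dots>, a\<^sub>2 + 1\<close> when \<open>a\<^sub>1 = 1\<close>; this disagrees with that column as soon as \<open>r \<ge> 2\<close>, so the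
  theorem is stated with the ranges read off from it.\<close>

definition P_mat :: "(nat \<Rightarrow> int \<Rightarrow> 'k::field ratfun) \<Rightarrow> (nat \<Rightarrow> int) \<Rightarrow> nat \<Rightarrow> 'k ratfun mat" where
  "P_mat R m r =
     F_mat m r
     * mat_prod (r + 1) (map (d_mat R m r) [1..<r + 2])
     * mat_prod (r + 1) (map (e_mat R m r) (tau r m))"


text \<open>The two-sided inverse of an invertible square matrix over a ring; unspecified for other
  matrices.\<close>

definition mat_inv :: "'a::semiring_1 mat \<Rightarrow> 'a mat" where
  "mat_inv A = (THE B. inverts_mat A B \<and> inverts_mat B A)"

text \<open>Matrix entries counted from 1.\<close>

definition entry :: "'a mat \<Rightarrow> nat \<Rightarrow> nat \<Rightarrow> 'a" where
  "entry A i j = A $$ (i - 1, j - 1)"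

end

theory Submission
  imports Defs "Jordan_Normal_Form.Determinant" "HOL-Library.Sublist"
begin

text \<open>
  Multiplying by \<open>F\<close> reduces the identity to \<open>I - T' = F\<^bsup>-1\<^esup> - t D E\<close>, where \<open>D\<close> and \<open>E\<close> are the diagonal and
  the upper triangular factor of \<open>P\<close>. The matrices \<open>E\<close>, the transpose of \<open>F\<close>, and the transpose of its
  inverse are all products of elementary matrices \<open>I + c\<^sub>i E\<^bsub>i,i+1\<^esub>\<close>, each \<open>i\<close> occurring once. The entry \<open>(q, p)\<close>
  of such a product is \<open>c\<^sub>q \<cdots> c\<^bsub>p-1\<^esub>\<close> if \<open>q, q + 1, \<dots>, p - 1\<close> occur in this order among the factors, and \<open>0\<close>
  otherwise. In \<open>\<sigma>\<close> (in \<open>\<tau>\<close>) the index \<open>j\<close> precedes \<open>j + 1\<close> exactly when the path ascends (descends) from \<open>j\<close>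
  to \<open>j + 1\<close>, so the nonzero entries are those of the edges along ascending (descending) segments. Cancelling
  the weights \<open>y\<^bsub>2i-1\<^esub>\<close> needs them to be nonzero: the \<open>Q\<close>-system is subtraction-free.
\<close>

section \<open>Solutions of the \<open>Q\<close>-system do not vanish\<close>

text \<open>Sums of monomials with coefficient 1, that is, polynomials whose coefficients come from
  natural numbers. Generating them one monomial at a time lets closure under sums and products
  follow by induction on one argument.\<close>

inductive_set nat_poly :: "('a::monoid_add \<Rightarrow>\<^sub>0 'k::semiring_1) set" where
  zero: "0 \<in> nat_poly"
| plus_single: "p \<in> nat_poly \<Longrightarrow> p + Poly_Mapping.single v 1 \<in> nat_poly"

lemma nat_poly_add: "q \<in> nat_poly \<Longrightarrow> p \<in> nat_poly \<Longrightarrow> p + q \<in> nat_poly"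
  by (induction q rule: nat_poly.induct)
     (auto simp: add.assoc[symmetric] intro: nat_poly.intros)

lemma nat_poly_single: "Poly_Mapping.single v 1 \<in> nat_poly"
  using nat_poly.plus_single[OF nat_poly.zero] by simp

lemma nat_poly_mult_single: "p \<in> nat_poly \<Longrightarrow> p * Poly_Mapping.single v 1 \<in> nat_poly"
  by (induction p rule: nat_poly.induct)
     (auto simp: distrib_right mult_single intro: nat_poly.intros)

lemma nat_poly_mult: "q \<in> nat_poly \<Longrightarrow> p \<in> nat_poly \<Longrightarrow> p * q \<in> nat_poly"
  by (induction q rule: nat_poly.induct)
     (auto simp: distrib_left intro: nat_poly_mult_single nat_poly_add nat_poly.zero)

lemma nat_poly_coeff: "p \<in> nat_poly \<Longrightarrow> \<exists>k. Poly_Mapping.lookup p v = of_nat k"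
proof (induction p rule: nat_poly.induct)
  case zero
  then show ?case by (auto intro: exI[of _ 0])
next
  case (plus_single p w)
  then obtain k where k: "Poly_Mapping.lookup p v = of_nat k" by blast
  have "Poly_Mapping.lookup (p + Poly_Mapping.single w 1) v
      = of_nat (k + (if w = v then 1 else 0))"
    by (simp add: lookup_add lookup_single k when_def)
  then show ?case by blast
qed

text \<open>No cancellation: in characteristic 0 two coefficients coming from natural numbers add up
  to zero only if both are zero.\<close>

lemma nat_poly_add_eq_0:
  fixes p q :: "'a::monoid_add \<Rightarrow>\<^sub>0 'k::semiring_char_0"
  assumes "p \<in> nat_poly" "q \<in> nat_poly" "p + q = 0"
  shows "p = 0"
proof (rule poly_mapping_eqI)
  fix v
  obtain k l where k: "Poly_Mapping.lookup p v = of_nat k" and l: "Poly_Mapping.lookup q v = of_nat l"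
    using nat_poly_coeff assms(1,2) by metis
  have "of_nat (k + l) = (0::'k)"
    using arg_cong[OF assms(3), of "\<lambda>p. Poly_Mapping.lookup p v"] k l by (simp add: lookup_add)
  then have "k = 0" by (simp only: of_nat_eq_0_iff)
  then show "Poly_Mapping.lookup p v = Poly_Mapping.lookup 0 v" by (simp add: k)
qed

text \<open>A strengthening of being nonzero that, unlike being nonzero itself, is stable under
  addition and can therefore be carried through the recurrence.\<close>

definition subtraction_free :: "'k::field ratfun \<Rightarrow> bool" where
  "subtraction_free x \<longleftrightarrow>
    (\<exists>p q. p \<in> nat_poly \<and> q \<in> nat_poly \<and> p \<noteq> 0 \<and> q \<noteq> 0 \<and> x = Fraction_Field.Fract p q)"

lemma subtraction_free_nonzero: "subtraction_free x \<Longrightarrow> x \<noteq> 0"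
  by (auto simp: subtraction_free_def Zero_fract_def eq_fract)

lemma subtraction_free_add:
  fixes x y :: "'k::field_char_0 ratfun"
  assumes "subtraction_free x" "subtraction_free y"
  shows "subtraction_free (x + y)"
proof -
  obtain a b where ab: "a \<in> nat_poly" "b \<in> nat_poly" "a \<noteq> 0" "b \<noteq> 0" "x = Fraction_Field.Fract a b"
    using assms(1) unfolding subtraction_free_def by blast
  obtain c d where cd: "c \<in> nat_poly" "d \<in> nat_poly" "c \<noteq> 0" "d \<noteq> 0" "y = Fraction_Field.Fract c d"
    using assms(2) unfolding subtraction_free_def by blast
  \<comment> \<open>If the numerator over the common denominator vanished, its summand
    \<open>a * d\<close> would vanish too, although both factors are nonzero.\<close>
  have "a * d + c * b \<noteq> 0"
    using nat_poly_add_eq_0[OF nat_poly_mult[OF cd(2) ab(1)] nat_poly_mult[OF ab(2) cd(1)]] ab cd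
    by auto
  moreover have "x + y = Fraction_Field.Fract (a * d + c * b) (b * d)"
    using ab cd by simp
  ultimately show ?thesis
    unfolding subtraction_free_def using ab cd
    by (metis nat_poly_add nat_poly_mult no_zero_divisors)
qed

lemma subtraction_free_mult:
  assumes "subtraction_free x" "subtraction_free y"
  shows "subtraction_free (x * y)"
  using assms unfolding subtraction_free_def
  by (metis mult_fract nat_poly_mult no_zero_divisors)

lemma subtraction_free_divide:
  assumes "subtraction_free x" "subtraction_free y"
  shows "subtraction_free (x / y)"
  using assms unfolding subtraction_free_def
  by (metis divide_fract nat_poly_mult no_zero_divisors)

lemma subtraction_free_indet: "subtraction_free (indet v)"
proof -
  have "Poly_Mapping.single (Poly_Mapping.single v 1) 1 \<noteq> (0 :: (nat \<Rightarrow>\<^sub>0 nat) \<Rightarrow>\<^sub>0 'a)"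
    by (metis lookup_single_eq lookup_zero one_neq_zero)
  then show ?thesis
    unfolding subtraction_free_def indet_def
    by (metis nat_poly_single single_one one_neq_zero)
qed

lemma subtraction_free_1: "subtraction_free 1"
  unfolding subtraction_free_def One_fract_def
  by (metis nat_poly_single single_one one_neq_zero)

text \<open>Solving the relation for the value at \<open>n + 1\<close> or at \<open>n - 1\<close>
  uses only sums, products and one division, and the divisor is nonzero because it is
  subtraction-free itself.\<close>

lemma Q_system_subtraction_free:
  fixes R :: "nat \<Rightarrow> int \<Rightarrow> 'k::field_char_0 ratfun"
  assumes Q: "Q_system r R" and "\<alpha> \<le> r + 1"
  shows "subtraction_free (R \<alpha> n)"
proof -
  \<comment> \<open>The relation at \<alpha> involves the neighbours \<alpha> - 1 and \<alpha> + 1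
    at the same \<open>n\<close>, so the induction has to treat all \<alpha> at once.\<close>
  define S where "S n \<longleftrightarrow> (\<forall>\<alpha>\<le>r + 1. subtraction_free (R \<alpha> n))" for n
  have boundary: "R 0 n = 1" "R (r + 1) n = 1" for n
    using Q by (auto simp: Q_system_def)
  have rhs: "subtraction_free ((R \<alpha> n)\<^sup>2 + R (\<alpha> + 1) n * R (\<alpha> - 1) n)"
    if "S n" "1 \<le> \<alpha>" "\<alpha> \<le> r" for \<alpha> n
    using that unfolding S_def power2_eq_square
    by (intro subtraction_free_add subtraction_free_mult) auto
  have step: "R \<alpha> (n + 1) * R \<alpha> (n - 1) = (R \<alpha> n)\<^sup>2 + R (\<alpha> + 1) n * R (\<alpha> - 1) n"
    if "1 \<le> \<alpha>" "\<alpha> \<le> r" for \<alpha> n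
    using Q that by (auto simp: Q_system_def)
  have interior: "S n" if "\<And>\<alpha>. 1 \<le> \<alpha> \<Longrightarrow> \<alpha> \<le> r \<Longrightarrow> subtraction_free (R \<alpha> n)" for n
    unfolding S_def
  proof (intro allI impI)
    fix \<alpha> assume "\<alpha> \<le> r + 1"
    then consider "\<alpha> = 0" | "\<alpha> = r + 1" | "1 \<le> \<alpha>" "\<alpha> \<le> r" by linarith
    then show "subtraction_free (R \<alpha> n)"
      using boundary subtraction_free_1 that by cases auto
  qed
  have up: "S (n + 1)" if "S n" "S (n - 1)" for n
  proof (rule interior)
    fix \<alpha> assume \<alpha>: "1 \<le> \<alpha>" "\<alpha> \<le> r"
    then have free: "subtraction_free (R \<alpha> (n - 1))" using that(2) by (simp add: S_def)
    then have "R \<alpha> (n + 1) = ((R \<alpha> n)\<^sup>2 + R (\<alpha> + 1) n * R (\<alpha> - 1) n) / R \<alpha> (n - 1)"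
      using step[OF \<alpha>, of n] subtraction_free_nonzero[OF free] by (simp add: eq_divide_eq)
    then show "subtraction_free (R \<alpha> (n + 1))"
      using subtraction_free_divide[OF rhs[OF that(1) \<alpha>] free] by simp
  qed
  have down: "S (n - 1)" if "S n" "S (n + 1)" for n
  proof (rule interior)
    fix \<alpha> assume \<alpha>: "1 \<le> \<alpha>" "\<alpha> \<le> r"
    then have free: "subtraction_free (R \<alpha> (n + 1))" using that(2) by (simp add: S_def)
    then have "R \<alpha> (n - 1) = ((R \<alpha> n)\<^sup>2 + R (\<alpha> + 1) n * R (\<alpha> - 1) n) / R \<alpha> (n + 1)"
      using step[OF \<alpha>, of n] subtraction_free_nonzero[OF free]
      by (simp add: eq_divide_eq mult.commute)
    then show "subtraction_free (R \<alpha> (n - 1))"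
      using subtraction_free_divide[OF rhs[OF that(1) \<alpha>] free] by simp
  qed
  \<comment> \<open>The recurrence has second order in \<open>n\<close>, so its state is a pair of
    consecutive slices; it is propagated from \<open>n = 0\<close> in both directions.\<close>
  have "S n \<and> S (n + 1)"
  proof (induction n rule: int_induct[where k = 0])
    case base
    show ?case
      using interior Q by (auto simp: Q_system_def subtraction_free_indet)
  next
    case (step1 i)
    then show ?case using up[of "i + 1"] by simp
  next
    case (step2 i)
    then show ?case using down[of i] by simp
  qed
  then show ?thesis using assms(2) by (simp add: S_def)
qed

lemma y_odd_nonzero:
  fixes R :: "nat \<Rightarrow> int \<Rightarrow> 'k::field_char_0 ratfun"
  assumes "Q_system r R" "\<alpha> \<le> r + 1"
  shows "y_odd R m \<alpha> \<noteq> 0"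
proof -
  have "R \<beta> n \<noteq> 0" if "\<beta> \<le> \<alpha>" for \<beta> n
    using Q_system_subtraction_free[OF assms(1), of \<beta> n] subtraction_free_nonzero that assms(2)
    by auto
  then show ?thesis by (simp add: y_odd_def lam_def)
qed

section \<open>Segments and the order of the factors\<close>

text \<open>A condition on single steps passes to subintervals and to unions of overlapping
  intervals at once, which the closed formula for \<open>m\<close> does not show.\<close>

lemma segment_iff:
  "segment s r m \<alpha> \<beta> \<longleftrightarrow>
    1 \<le> \<alpha> \<and> \<alpha> < \<beta> \<and> \<beta> \<le> r \<and> (\<forall>j\<in>{\<alpha>..<\<beta>}. m (Suc j) = m j + s)"
proof -
  have "(\<forall>j\<le>\<beta> - \<alpha>. m (\<alpha> + j) = m \<alpha> + s * int j) \<longleftrightarrow> (\<forall>j\<in>{\<alpha>..<\<beta>}. m (Suc j) = m j + s)"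
    if "\<alpha> < \<beta>"
  proof
    assume L: "\<forall>j\<le>\<beta> - \<alpha>. m (\<alpha> + j) = m \<alpha> + s * int j"
    show "\<forall>j\<in>{\<alpha>..<\<beta>}. m (Suc j) = m j + s"
    proof
      fix j assume "j \<in> {\<alpha>..<\<beta>}"
      then show "m (Suc j) = m j + s"
        using L[rule_format, of "j - \<alpha>"] L[rule_format, of "Suc (j - \<alpha>)"]
        by (simp add: Suc_le_eq diff_less_mono le_diff_iff algebra_simps)
    qed
  next
    assume *: "\<forall>j\<in>{\<alpha>..<\<beta>}. m (Suc j) = m j + s"
    have "j \<le> \<beta> - \<alpha> \<Longrightarrow> m (\<alpha> + j) = m \<alpha> + s * int j" for j
      using * that by (induction j) (auto simp: algebra_simps)
    then show "\<forall>j\<le>\<beta> - \<alpha>. m (\<alpha> + j) = m \<alpha> + s * int j" by blast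
  qed
  then show ?thesis unfolding segment_def by blast
qed

lemma max_segment_segment: "max_segment s r m \<alpha> \<beta> \<Longrightarrow> segment s r m \<alpha> \<beta>"
  by (simp add: max_segment_def)

text \<open>All segments lie in \<open>{1..r}\<close>, so among those containing the given one there
  is a longest, and it is maximal.\<close>

lemma segment_extend:
  assumes "segment s r m \<alpha> \<beta>"
  shows "\<exists>\<alpha>' \<beta>'. max_segment s r m \<alpha>' \<beta>' \<and> \<alpha>' \<le> \<alpha> \<and> \<beta> \<le> \<beta>'"
proof -
  let ?P = "\<lambda>(\<alpha>', \<beta>'). segment s r m \<alpha>' \<beta>' \<and> \<alpha>' \<le> \<alpha> \<and> \<beta> \<le> \<beta>'"
  have "\<forall>x. ?P x \<longrightarrow> snd x - fst x < r + 1"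
    by (auto simp: segment_def)
  then obtain x where x: "?P x" "\<forall>y. ?P y \<longrightarrow> snd y - fst y \<le> snd x - fst x"
    using ex_has_greatest_nat[of ?P "(\<alpha>, \<beta>)" "\<lambda>x. snd x - fst x" "r + 1"] assms by auto
  obtain a b where ab: "x = (a, b)" by fastforce
  have "max_segment s r m a b"
    unfolding max_segment_def
  proof (intro conjI allI impI; (elim conjE)?)
    show "segment s r m a b" using x(1) ab by simp
    fix a' b' assume seg: "segment s r m a' b'" and sub: "{a..b} \<subseteq> {a'..b'}"
    have less: "a < b" "a' < b'" using \<open>segment s r m a b\<close> seg by (auto simp: segment_def)
    have le: "a' \<le> a" "b \<le> b'" using sub less by auto
    then have "b' - a' \<le> b - a" using x seg ab by fastforce
    then show "a' = a" "b' = b" using le less by linarith+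
  qed
  then show ?thesis using x(1) ab by auto
qed

text \<open>The union of two segments of equal slope with a common index is again a segment, so by
  maximality each of them equals the union.\<close>

lemma max_segment_unique:
  assumes "max_segment s r m \<alpha> \<beta>" "max_segment s r m \<alpha>' \<beta>'"
    and "v \<in> {\<alpha>..\<beta>}" "v \<in> {\<alpha>'..\<beta>'}"
  shows "\<alpha> = \<alpha>' \<and> \<beta> = \<beta>'"
proof -
  have "segment s r m (min \<alpha> \<alpha>') (max \<beta> \<beta>')"
    using assms unfolding max_segment_def segment_iff by (auto simp: min_def max_def)
  moreover have "{\<alpha>..\<beta>} \<subseteq> {min \<alpha> \<alpha>'..max \<beta> \<beta>'}" "{\<alpha>'..\<beta>'} \<subseteq> {min \<alpha> \<alpha>'..max \<beta> \<beta>'}"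
    by auto
  ultimately have "min \<alpha> \<alpha>' = \<alpha> \<and> max \<beta> \<beta>' = \<beta>" "min \<alpha> \<alpha>' = \<alpha>' \<and> max \<beta> \<beta>' = \<beta>'"
    using assms(1,2) unfolding max_segment_def by (metis (no_types, lifting))+
  then show ?thesis by simp
qed

text \<open>Used to remove maximal segments from the description of the edges: what remains is a
  condition on the steps of the path.\<close>

lemma ex_max_segment_iff:
  assumes "a < b"
  shows "(\<exists>\<alpha> \<beta>. max_segment s r m \<alpha> \<beta> \<and> \<alpha> \<le> a \<and> b \<le> \<beta>) \<longleftrightarrow> segment s r m a b"
proof
  assume "\<exists>\<alpha> \<beta>. max_segment s r m \<alpha> \<beta> \<and> \<alpha> \<le> a \<and> b \<le> \<beta>"
  then show "segment s r m a b"
    using assms by (auto simp: segment_iff dest!: max_segment_segment)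
qed (rule segment_extend)

section \<open>Reversal of the blocks and the relative order of neighbouring indices\<close>

lemma flip_in:
  assumes "max_segment s r m \<alpha> \<beta>" "v \<in> {\<alpha>..\<beta>}"
  shows "flip s r m v = \<alpha> + \<beta> - v"
proof -
  have "(THE w. \<exists>\<alpha> \<beta>. max_segment s r m \<alpha> \<beta> \<and> v \<in> {\<alpha>..\<beta>} \<and> w = \<alpha> + \<beta> - v) = \<alpha> + \<beta> - v"
    using assms max_segment_unique by (intro the_equality) blast+
  then show ?thesis using assms unfolding flip_def by metis
qed

lemma flip_out:
  assumes "\<nexists>\<alpha> \<beta>. max_segment s r m \<alpha> \<beta> \<and> v \<in> {\<alpha>..\<beta>}"
  shows "flip s r m v = v"
  using assms unfolding flip_def by meson

lemma flip_involution [simp]: "flip s r m (flip s r m v) = v"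
proof (cases "\<exists>\<alpha> \<beta>. max_segment s r m \<alpha> \<beta> \<and> v \<in> {\<alpha>..\<beta>}")
  case True
  then obtain \<alpha> \<beta> where *: "max_segment s r m \<alpha> \<beta>" "v \<in> {\<alpha>..\<beta>}" by blast
  then have "\<alpha> + \<beta> - v \<in> {\<alpha>..\<beta>}" by auto
  then show ?thesis using flip_in[OF *] flip_in[OF *(1)] * by auto
qed (simp add: flip_out)

lemma flip_range: "v \<in> {1..r} \<Longrightarrow> flip s r m v \<in> {1..r}"
proof (cases "\<exists>\<alpha> \<beta>. max_segment s r m \<alpha> \<beta> \<and> v \<in> {\<alpha>..\<beta>}")
  case True
  then obtain \<alpha> \<beta> where *: "max_segment s r m \<alpha> \<beta>" "v \<in> {\<alpha>..\<beta>}" by blast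
  then show ?thesis
    using flip_in[OF *] max_segment_segment[OF *(1)] by (auto simp: segment_def)
qed (simp add: flip_out)

text \<open>A step of slope \<open>s\<close> puts \<open>j\<close> and \<open>j + 1\<close> into one
  maximal segment, where the reflection reverses their order. Without such a step, \<open>j\<close>
  can only be the right end of a block and \<open>j + 1\<close> only the left end of one, so
  \<open>flip\<close> does not raise \<open>j\<close> and does not lower
  \<open>j + 1\<close>.\<close>

lemma flip_descent_iff:
  assumes "1 \<le> j" "j < r"
  shows "flip s r m (Suc j) < flip s r m j \<longleftrightarrow> m (Suc j) = m j + s"
proof
  assume "m (Suc j) = m j + s"
  then have "segment s r m j (Suc j)" using assms by (auto simp: segment_iff)
  then obtain \<alpha> \<beta> where "max_segment s r m \<alpha> \<beta>" "\<alpha> \<le> j" "Suc j \<le> \<beta>"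
    using segment_extend by blast
  then show "flip s r m (Suc j) < flip s r m j"
    using flip_in[of s r m \<alpha> \<beta> j] flip_in[of s r m \<alpha> \<beta> "Suc j"] by auto
next
  assume less: "flip s r m (Suc j) < flip s r m j"
  show "m (Suc j) = m j + s"
  proof (rule ccontr)
    assume ne: "m (Suc j) \<noteq> m j + s"
    have "flip s r m j \<le> j"
    proof (cases "\<exists>\<alpha> \<beta>. max_segment s r m \<alpha> \<beta> \<and> j \<in> {\<alpha>..\<beta>}")
      case True
      then obtain \<alpha> \<beta> where *: "max_segment s r m \<alpha> \<beta>" "j \<in> {\<alpha>..\<beta>}" by blast
      then have "\<beta> = j"
        using ne by (force simp: segment_iff dest!: max_segment_segment)
      then show ?thesis using flip_in[OF *] * by auto
    qed (simp add: flip_out)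
    moreover have "Suc j \<le> flip s r m (Suc j)"
    proof (cases "\<exists>\<alpha> \<beta>. max_segment s r m \<alpha> \<beta> \<and> Suc j \<in> {\<alpha>..\<beta>}")
      case True
      then obtain \<alpha> \<beta> where *: "max_segment s r m \<alpha> \<beta>" "Suc j \<in> {\<alpha>..\<beta>}" by blast
      then have "\<alpha> = Suc j"
        using ne by (force simp: segment_iff dest!: max_segment_segment)
      then show ?thesis using flip_in[OF *] * by auto
    qed (simp add: flip_out)
    ultimately show False using less by simp
  qed
qed

lemma flip_ascent_iff:
  assumes "1 \<le> j" "j < r"
  shows "flip s r m j < flip s r m (Suc j) \<longleftrightarrow> m (Suc j) \<noteq> m j + s"
proof -
  have "flip s r m j \<noteq> flip s r m (Suc j)"
    using flip_involution n_not_Suc_n by metis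
  then show ?thesis using flip_descent_iff[OF assms, of s m] by auto
qed

section \<open>Runs of consecutive indices as subsequences of the reordered lists\<close>

lemma subseq_sorted_wrt_iff:
  assumes "sorted_wrt P ys" "irreflp P" "asymp P"
  shows "subseq xs ys \<longleftrightarrow> sorted_wrt P xs \<and> set xs \<subseteq> set ys"
  using assms(1)
proof (induction ys arbitrary: xs)
  case Nil
  then show ?case by (cases xs) auto
next
  case (Cons y ys)
  have y: "y \<notin> set ys" using Cons.prems assms(2) by (auto simp: irreflp_def)
  show ?case
  proof (cases xs)
    case (Cons x xs')
    show ?thesis
    proof (cases "x = y")
      case True
      then show ?thesis
        using Cons.IH[of xs'] Cons.prems y assms(2) by (auto simp: Cons irreflp_def)
    next
      case False
      have "y \<notin> set xs'" if "x \<in> set ys" "\<forall>z\<in>set xs'. P x z"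
        using that Cons.prems asympD[OF assms(3)] by auto
      then show ?thesis
        using Cons.IH[of "x # xs'"] Cons.prems False by (auto simp: Cons)
    qed
  qed simp
qed

text \<open>Applying the involution \<open>g\<close> to both lists moves it from the long list to
  the interval. The long list is then sorted, so being a subsequence means that the image of the
  interval is sorted, and by transitivity it is enough to compare neighbours.\<close>

lemma subseq_upt_map_iff:
  assumes inv: "\<And>v. g (g v) = v" and range: "\<And>v. v \<in> {1..r} \<Longrightarrow> g v \<in> {1..r}"
    and P: "sorted_wrt P zs" "irreflp P" "asymp P" "transp P" "set zs = {1..r}"
    and "1 \<le> a" "b \<le> Suc r"
  shows "subseq [a..<b] (map g zs) \<longleftrightarrow> (\<forall>j. a \<le> j \<and> Suc j < b \<longrightarrow> P (g j) (g (Suc j)))"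
proof -
  have "subseq [a..<b] (map g zs) \<longleftrightarrow> subseq (map g [a..<b]) zs"
    using subseq_map[of "[a..<b]" "map g zs" g] subseq_map[of "map g [a..<b]" zs g]
    by (auto simp: inv comp_def)
  also have "\<dots> \<longleftrightarrow> sorted_wrt P (map g [a..<b]) \<and> set (map g [a..<b]) \<subseteq> set zs"
    by (rule subseq_sorted_wrt_iff[OF P(1-3)])
  also have "\<dots> \<longleftrightarrow> sorted_wrt P (map g [a..<b])"
    using range assms(8,9) P(5) by fastforce
  also have "\<dots> \<longleftrightarrow> (\<forall>j. Suc j < b - a \<longrightarrow> P (g (a + j)) (g (Suc (a + j))))"
    by (simp add: sorted_wrt_iff_nth_Suc_transp[OF P(4)])
  also have "\<dots> \<longleftrightarrow> (\<forall>j. a \<le> j \<and> Suc j < b \<longrightarrow> P (g j) (g (Suc j)))"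
  proof safe
    fix j assume *: "\<forall>j. Suc j < b - a \<longrightarrow> P (g (a + j)) (g (Suc (a + j)))" and j: "a \<le> j" "Suc j < b"
    have "Suc (j - a) < b - a" using j by simp
    with * have "P (g (a + (j - a))) (g (Suc (a + (j - a))))" by blast
    then show "P (g j) (g (Suc j))" using j(1) by simp
  qed auto
  finally show ?thesis .
qed

text \<open>The order is \<open>>\<close> here, since the list before the reversals is decreasing.
  The slope 1 gives \<sigma> and the slope -1 gives \<tau>.\<close>

lemma subseq_flip_iff:
  assumes "1 \<le> a" "b \<le> Suc r"
  shows "subseq [a..<b] (map (flip s r m) (rev [1..<r + 1])) \<longleftrightarrow>
    (\<forall>j. a \<le> j \<and> Suc j < b \<longrightarrow> m (Suc j) = m j + s)"
proof -
  have "subseq [a..<b] (map (flip s r m) (rev [1..<r + 1])) \<longleftrightarrow>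
    (\<forall>j. a \<le> j \<and> Suc j < b \<longrightarrow> flip s r m j > flip s r m (Suc j))"
    using assms flip_range sorted_wrt_upt[of 1 "r + 1"]
    by (intro subseq_upt_map_iff[where r = r and g = "flip s r m"])
       (auto simp: sorted_wrt_rev simp del: upt_Suc simp: irreflp_def transp_def asymp_on_def)
  also have "\<dots> \<longleftrightarrow> (\<forall>j. a \<le> j \<and> Suc j < b \<longrightarrow> m (Suc j) = m j + s)"
    using assms flip_descent_iff[of _ r s m] by (smt (verit) Suc_less_eq le_trans less_le_trans)
  finally show ?thesis .
qed

text \<open>Needed for \<open>F\<close> itself: transposing the product reverses \<sigma>, and
  reversing the list turns each comparison of neighbours into its negation.\<close>

lemma subseq_rev_flip_iff:
  assumes "1 \<le> a" "b \<le> Suc r"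
  shows "subseq [a..<b] (rev (map (flip s r m) (rev [1..<r + 1]))) \<longleftrightarrow>
    (\<forall>j. a \<le> j \<and> Suc j < b \<longrightarrow> m (Suc j) \<noteq> m j + s)"
proof -
  have "subseq [a..<b] (map (flip s r m) [1..<r + 1]) \<longleftrightarrow>
    (\<forall>j. a \<le> j \<and> Suc j < b \<longrightarrow> flip s r m j < flip s r m (Suc j))"
    using assms flip_range sorted_wrt_upt[of 1 "r + 1"]
    by (intro subseq_upt_map_iff[where r = r and g = "flip s r m"])
       (auto simp del: upt_Suc simp: irreflp_def transp_def asymp_on_def)
  also have "\<dots> \<longleftrightarrow> (\<forall>j. a \<le> j \<and> Suc j < b \<longrightarrow> m (Suc j) \<noteq> m j + s)"
    using assms flip_ascent_iff[of _ r s m] by (smt (verit) Suc_less_eq le_trans less_le_trans)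
  finally show ?thesis by (simp only: rev_map rev_rev_ident)
qed

lemma flip_list:
  "distinct (map (flip s r m) (rev [1..<r + 1]))"
  "set (map (flip s r m) (rev [1..<r + 1])) \<subseteq> {1..r}"
proof -
  have "inj (flip s r m)" by (metis flip_involution injI)
  then show "distinct (map (flip s r m) (rev [1..<r + 1]))"
    unfolding distinct_map by (simp add: inj_on_def)
  show "set (map (flip s r m) (rev [1..<r + 1])) \<subseteq> {1..r}"
    using flip_range[of _ r s m] by fastforce
qed

section \<open>Products of elementary matrices\<close>

lemma mat_prod_Nil [simp]: "mat_prod n [] = 1\<^sub>m n"
  and mat_prod_Cons [simp]: "mat_prod n (M # Ms) = M * mat_prod n Ms"
  by (simp_all add: mat_prod_def)

lemma mat_prod_carrier [simp]:
  "set Ms \<subseteq> carrier_mat n n \<Longrightarrow> mat_prod n Ms \<in> carrier_mat n n"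
  by (induction Ms) auto

lemma mat_prod_snoc:
  assumes "set Ms \<subseteq> carrier_mat n n" "M \<in> carrier_mat n n"
  shows "mat_prod n (Ms @ [M]) = mat_prod n Ms * M"
  using assms by (induction Ms) (auto simp: assoc_mult_mat[of _ n n _ n _ n])

lemma transpose_mat_prod:
  fixes Ms :: "'a::comm_semiring_1 mat list"
  assumes "set Ms \<subseteq> carrier_mat n n"
  shows "(mat_prod n Ms)\<^sup>T = mat_prod n (rev (map transpose_mat Ms))"
  using assms
proof (induction Ms)
  case (Cons M Ms)
  have "mat_prod n (rev (map transpose_mat Ms) @ [M\<^sup>T]) = mat_prod n (rev (map transpose_mat Ms)) * M\<^sup>T"
    using Cons.prems by (intro mat_prod_snoc) auto
  then show ?case
    using Cons by (simp add: transpose_mult[of _ n n _ n])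
qed simp

lemma mult_mat_index:
  assumes "A \<in> carrier_mat n n" "B \<in> carrier_mat n n" "a < n" "b < n"
  shows "(A * B) $$ (a, b) = (\<Sum>k<n. A $$ (a, k) * B $$ (k, b))"
  using assms by (auto simp: scalar_prod_def lessThan_atLeast0 intro!: sum.cong)

text \<open>The scalar is a function of the index so that one formula serves three products: the
  constant 1 gives the transpose of \<open>F\<close>, the constant -1 that of its inverse, and the
  quotients of weights give the factors \<open>e_mat\<close>.\<close>

definition upper_elem :: "nat \<Rightarrow> (nat \<Rightarrow> 'a::comm_ring_1) \<Rightarrow> nat \<Rightarrow> 'a mat" where
  "upper_elem n c i = 1\<^sub>m n + c i \<cdot>\<^sub>m mat_unit n i (i + 1)"

lemma upper_elem_carrier [simp]: "upper_elem n c i \<in> carrier_mat n n"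
  by (simp add: upper_elem_def mat_unit_def)

text \<open>A row operation: row \<open>i\<close> receives \<open>c i\<close> times row
  \<open>i + 1\<close>, counted from 1. In the library's numbering from 0 the latter is row
  \<open>i\<close>.\<close>

lemma upper_elem_mult_index:
  assumes M: "M \<in> carrier_mat n n" and "1 \<le> i" "i < n" "a < n" "b < n"
  shows "(upper_elem n c i * M) $$ (a, b) = M $$ (a, b) + (if a + 1 = i then c i * M $$ (i, b) else 0)"
proof -
  have "(upper_elem n c i * M) $$ (a, b)
      = (\<Sum>k<n. upper_elem n c i $$ (a, k) * M $$ (k, b))"
    using assms by (intro mult_mat_index) auto
  also have "\<dots> = (\<Sum>k<n. (if k = a then M $$ (k, b) else 0)
      + (if k = i then (if a + 1 = i then c i * M $$ (i, b) else 0) else 0))"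
    using assms by (intro sum.cong) (auto simp: upper_elem_def mat_unit_def)
  also have "\<dots> = M $$ (a, b) + (if a + 1 = i then c i * M $$ (i, b) else 0)"
    using assms by (simp add: sum.distrib)
  finally show ?thesis .
qed

definition upper_prod :: "nat \<Rightarrow> (nat \<Rightarrow> 'a::comm_ring_1) \<Rightarrow> nat list \<Rightarrow> 'a mat" where
  "upper_prod n c is = mat_prod n (map (upper_elem n c) is)"

lemma upper_prod_carrier [simp]: "upper_prod n c is \<in> carrier_mat n n"
  unfolding upper_prod_def by (intro mat_prod_carrier) auto

lemma upper_prod_dim [simp]:
  "dim_row (upper_prod n c is) = n" "dim_col (upper_prod n c is) = n"
  using upper_prod_carrier by blast+

text \<open>Expanding the product, a nonzero contribution to the entry must pick the off-diagonal
  units of consecutive indices from left to right. As the indices are distinct, there is at most one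
  such choice. The interval starts at \<open>Suc a\<close> because matrix positions count from 0 and
  indices from 1.\<close>

lemma upper_prod_index:
  assumes "distinct is" "set is \<subseteq> {1..<n}" "a < n" "b < n"
  shows "upper_prod n c is $$ (a, b) =
    (if a \<le> b \<and> subseq [Suc a..<Suc b] is then \<Prod>j=Suc a..<Suc b. c j else 0)"
  using assms
proof (induction "is" arbitrary: a)
  case Nil
  then show ?case by (auto simp: upper_prod_def)
next
  case (Cons i "is")
  have i: "1 \<le> i" "i < n" using Cons.prems by auto
  have "upper_prod n c (i # is) $$ (a, b) = (upper_elem n c i * upper_prod n c is) $$ (a, b)"
    by (simp add: upper_prod_def)
  also have "\<dots> = upper_prod n c is $$ (a, b)
      + (if a + 1 = i then c i * upper_prod n c is $$ (i, b) else 0)"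
    using Cons.prems i by (subst upper_elem_mult_index) auto
  also have "\<dots> = (if a \<le> b \<and> subseq [Suc a..<Suc b] (i # is) then \<Prod>j=Suc a..<Suc b. c j else 0)"
  proof (cases "a < b")
    case True
    then have upt: "[Suc a..<Suc b] = Suc a # [Suc (Suc a)..<Suc b]"
      by (simp add: upt_conv_Cons del: upt_Suc)
    have prod: "(\<Prod>j=Suc a..<Suc b. c j) = c (Suc a) * (\<Prod>j=Suc (Suc a)..<Suc b. c j)"
      using True by (simp add: prod.atLeast_Suc_lessThan del: prod.op_ivl_Suc)
    \<comment> \<open>By distinctness an index used by the leftmost factor does not return in the
      tail, so the two summands of the row operation are never both nonzero.\<close>
    have nosub: "\<not> subseq (Suc a # [Suc (Suc a)..<Suc b]) is" if "i = Suc a"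
    proof
      assume "subseq (Suc a # [Suc (Suc a)..<Suc b]) is"
      then have "Suc a \<in> set is" by (rule list_emb_ConsD[THEN exE]) auto
      then show False using that Cons.prems(1) by simp
    qed
    show ?thesis
      using True Cons nosub i unfolding upt prod
      by (auto simp: upt prod simp del: upt_Suc prod.op_ivl_Suc)
  next
    case False
    then show ?thesis using Cons i by (auto simp del: upt_Suc prod.op_ivl_Suc)
  qed
  finally show ?case .
qed

lemma upper_elem_inverse:
  assumes "1 \<le> i" "i < n"
  shows "upper_elem n c i * upper_elem n (\<lambda>j. - c j) i = 1\<^sub>m n"
proof (rule eq_matI)
  fix a b assume "a < dim_row (1\<^sub>m n :: 'a mat)" "b < dim_col (1\<^sub>m n :: 'a mat)"
  then show "(upper_elem n c i * upper_elem n (\<lambda>j. - c j) i) $$ (a, b) = 1\<^sub>m n $$ (a, b)"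
    using assms by (subst upper_elem_mult_index) (auto simp: upper_elem_def mat_unit_def)
qed (simp_all add: upper_elem_def mat_unit_def)

text \<open>The factors cancel in pairs from the middle outwards: the last factor of the reversed
  product meets the first factor of the other one.\<close>

lemma upper_prod_inverse:
  assumes "set is \<subseteq> {1..<n}"
  shows "upper_prod n c (rev is) * upper_prod n (\<lambda>j. - c j) is = 1\<^sub>m n"
  using assms
proof (induction "is")
  case Nil
  then show ?case by (simp add: upper_prod_def)
next
  case (Cons i "is")
  let ?c = "\<lambda>j. - c j"
  have "upper_prod n c (rev (i # is)) = upper_prod n c (rev is) * upper_elem n c i"
    unfolding upper_prod_def by (simp, subst mat_prod_snoc) auto
  moreover have "upper_prod n ?c (i # is) = upper_elem n ?c i * upper_prod n ?c is"
    by (simp add: upper_prod_def)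
  moreover have "upper_prod n c (rev is) * upper_elem n c i * (upper_elem n ?c i * upper_prod n ?c is)
      = upper_prod n c (rev is) * (upper_elem n c i * upper_elem n ?c i * upper_prod n ?c is)"
    by (simp add: assoc_mult_mat[of _ n n _ n _ n] mult_carrier_mat[of _ n n])
  ultimately show ?case
    using Cons by (simp add: upper_elem_inverse left_mult_one_mat[of _ n n])
qed

lemma diag_prod_index:
  fixes c :: "nat \<Rightarrow> 'a::comm_ring_1"
  assumes "distinct is" "a < n" "b < n"
  shows "mat_prod n (map (\<lambda>i. 1\<^sub>m n + (c i - 1) \<cdot>\<^sub>m mat_unit n i i) is) $$ (a, b) =
    (if a = b then if a + 1 \<in> set is then c (a + 1) else 1 else 0)"
  using assms(1,2)
proof (induction "is" arbitrary: a)
  case Nil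
  then show ?case using assms by auto
next
  case (Cons i "is")
  let ?D = "\<lambda>i. 1\<^sub>m n + (c i - 1) \<cdot>\<^sub>m mat_unit n i i"
  let ?M = "mat_prod n (map ?D is)"
  have M: "?M \<in> carrier_mat n n" by (intro mat_prod_carrier) (auto simp: mat_unit_def)
  have "(?D i * ?M) $$ (a, b) = (\<Sum>k<n. ?D i $$ (a, k) * ?M $$ (k, b))"
    using Cons.prems assms M by (intro mult_mat_index) (auto simp: mat_unit_def)
  also have "\<dots> = (\<Sum>k<n. if k = a then (if a + 1 = i then c i else 1) * ?M $$ (a, b) else 0)"
    using Cons.prems by (intro sum.cong) (auto simp: mat_unit_def)
  also have "\<dots> = (if a + 1 = i then c i else 1) * ?M $$ (a, b)"
    using Cons.prems by simp
  finally show ?case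
    using Cons by auto
qed

section \<open>Uniqueness of inverses, and invertibility over power series\<close>

lemma mat_inv_eqI:
  assumes A: "A \<in> carrier_mat n n" "B \<in> carrier_mat n n" and AB: "A * B = 1\<^sub>m n" "B * A = 1\<^sub>m n"
  shows "invertible_mat A" "mat_inv A = B"
proof -
  have inv: "inverts_mat A B" "inverts_mat B A"
    using assms by (auto simp: inverts_mat_def)
  then show "invertible_mat A"
    using A by (auto simp: invertible_mat_def)
  show "mat_inv A = B"
    unfolding mat_inv_def
  proof (rule the_equality)
    fix C assume C: "inverts_mat A C \<and> inverts_mat C A"
    then have AC: "A * C = 1\<^sub>m n" and CA: "C * A = 1\<^sub>m (dim_row C)"
      using A by (auto simp: inverts_mat_def)
    \<comment> \<open>The definition of \<open>mat_inv\<close> does not fix the size of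
      \<open>C\<close>; comparing the dimensions in the two identities shows that it is square of
      size \<open>n\<close>.\<close>
    have "dim_col (A * C) = n" "dim_col (C * A) = dim_row C" by (simp_all add: AC CA)
    then have C': "C \<in> carrier_mat n n" using A by (intro carrier_matI) simp_all
    have "C = (B * A) * C" using AB C' by simp
    also have "\<dots> = B * (A * C)" using A C' by (simp add: assoc_mult_mat[of _ n n _ n _ n])
    also have "\<dots> = B" using AC A by simp
    finally show "C = B" .
  qed (use inv in blast)
qed

text \<open>At t = 0 the matrix becomes the identity, and taking constant terms is a ring
  homomorphism, so the determinant has constant term 1 and is a unit. The adjugate then provides the
  inverse.\<close>

lemma one_minus_fps_X_mat_inverse:
  fixes M :: "'a::field mat"
  assumes M: "M \<in> carrier_mat n n"
  shows "\<exists>C \<in> carrier_mat n n. (1\<^sub>m n - fps_X \<cdot>\<^sub>m map_mat fps_const M) * C = 1\<^sub>m n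
    \<and> C * (1\<^sub>m n - fps_X \<cdot>\<^sub>m map_mat fps_const M) = 1\<^sub>m n"
proof -
  let ?B = "1\<^sub>m n - fps_X \<cdot>\<^sub>m map_mat fps_const M"
  let ?h = "\<lambda>f :: 'a fps. fps_nth f 0"
  have hom: "comm_ring_hom ?h" by unfold_locales simp_all
  have B: "?B \<in> carrier_mat n n"
    using M by (intro minus_carrier_mat smult_carrier_mat map_carrier_mat[THEN iffD2])
  have "map_mat ?h ?B = 1\<^sub>m n" using M by (intro eq_matI) auto
  then have "?h (det ?B) = 1"
    unfolding comm_ring_hom.hom_det[OF hom, symmetric] by (simp only: det_one)
  then have unit: "inverse (det ?B) * det ?B = 1" by (intro inverse_mult_eq_1) simp
  show ?thesis
  proof (intro bexI conjI)
    show "?B * (inverse (det ?B) \<cdot>\<^sub>m adj_mat ?B) = 1\<^sub>m n"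
      unfolding mult_smult_distrib[OF B adj_mat(1)[OF B]] adj_mat(2)[OF B]
      by (intro eq_matI) (simp_all add: unit)
    show "(inverse (det ?B) \<cdot>\<^sub>m adj_mat ?B) * ?B = 1\<^sub>m n"
      unfolding mult_smult_assoc_mat[OF adj_mat(1)[OF B] B] adj_mat(3)[OF B]
      by (intro eq_matI) (simp_all add: unit)
    show "inverse (det ?B) \<cdot>\<^sub>m adj_mat ?B \<in> carrier_mat n n"
      by (rule smult_carrier_mat[OF adj_mat(1)[OF B]])
  qed
qed

section \<open>The transfer matrix and its inverse\<close>

text \<open>Sorting the edges by the difference of their end points makes the cases exclusive, so
  the weight is unique and the description operator in \<open>transfer_mat\<close> can be evaluated.
  A maximal segment serves one vertex beyond its right end, whence the bounds \<open>a - 1\<close>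
  and \<open>b - 1\<close>.\<close>

lemma compact_edge_iff:
  assumes "1 \<le> a" "a \<le> r + 1" "1 \<le> b" "b \<le> r + 1"
  shows "compact_edge R m r a b w \<longleftrightarrow>
    b = a + 1 \<and> w = 1 \<or>
    a = b + 1 \<and> w = fps_X * fps_const (y_wt R m (2 * b)) \<or>
    a = b \<and> w = fps_X * fps_const (y_wt R m (2 * b - 1)) \<or>
    b + 2 \<le> a \<and> segment (-1) r m b (a - 1) \<and>
      w = fps_X * fps_const ((\<Prod>j=b..a - 1. y_wt R m (2 * j)) / (\<Prod>j=b + 1..a - 1. y_wt R m (2 * j - 1))) \<or>
    a + 2 \<le> b \<and> segment 1 r m a (b - 1) \<and> w = (-1) ^ (b - a - 1)"
    (is "?L \<longleftrightarrow> ?R")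
proof
  assume ?L
  then show ?R
  proof cases
    case (desc i \<alpha> q p)
    have "\<exists>\<alpha>' \<beta>'. max_desc r m \<alpha>' \<beta>' \<and> \<alpha>' \<le> b \<and> a - 1 \<le> \<beta>'"
      using desc by (intro exI[of _ \<alpha>] exI[of _ "\<alpha> + i - 1"]) auto
    then show ?thesis using desc ex_max_segment_iff[of b "a - 1" "-1" r m] by auto
  next
    case (asc i \<alpha> q p)
    have "\<exists>\<alpha>' \<beta>'. max_asc r m \<alpha>' \<beta>' \<and> \<alpha>' \<le> a \<and> b - 1 \<le> \<beta>'"
      using asc by (intro exI[of _ \<alpha>] exI[of _ "\<alpha> + i - 1"]) auto
    then show ?thesis using asc ex_max_segment_iff[of a "b - 1" 1 r m] by auto
  qed auto
next
  assume ?R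
  then consider (up) "b = a + 1" "w = 1"
    | (down) "a = b + 1" "w = fps_X * fps_const (y_wt R m (2 * b))"
    | (loop) "a = b" "w = fps_X * fps_const (y_wt R m (2 * b - 1))"
    | (desc) "b + 2 \<le> a" "segment (-1) r m b (a - 1)"
      "w = fps_X * fps_const ((\<Prod>j=b..a - 1. y_wt R m (2 * j)) / (\<Prod>j=b + 1..a - 1. y_wt R m (2 * j - 1)))"
    | (asc) "a + 2 \<le> b" "segment 1 r m a (b - 1)" "w = (-1) ^ (b - a - 1)"
    by blast
  then show ?L
  proof cases
    case up
    then show ?thesis using compact_edge.up[of a r R m] assms by simp
  next
    case down
    then show ?thesis using compact_edge.down[of b r R m] assms by simp
  next
    case loop
    then show ?thesis using compact_edge.loop[of a r R m] assms by simp
  next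
    case desc
    then obtain \<alpha> \<beta> where seg: "max_desc r m \<alpha> \<beta>" "\<alpha> \<le> b" "a - 1 \<le> \<beta>"
      using segment_extend by blast
    \<comment> \<open>The parameter \<open>i\<close> is the number of indices in the maximal
      segment, and \<open>q\<close>, \<open>p\<close> are the offsets of the end points from its
      left end.\<close>
    show ?thesis
      using compact_edge.desc[of "\<beta> + 1 - \<alpha>" r m \<alpha> "b - \<alpha>" "a - \<alpha>" R] seg desc by simp
  next
    case asc
    then obtain \<alpha> \<beta> where seg: "max_asc r m \<alpha> \<beta>" "\<alpha> \<le> a" "b - 1 \<le> \<beta>"
      using segment_extend by blast
    show ?thesis
      using compact_edge.asc[of "\<beta> + 1 - \<alpha>" r m \<alpha> "a - \<alpha>" "b - \<alpha>" R] seg asc by simp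
  qed
qed

lemma segment_Suc_iff:
  assumes "a + 1 < b" "b \<le> r"
  shows "segment s r m (Suc a) b \<longleftrightarrow> (\<forall>j. Suc a \<le> j \<and> Suc j < Suc b \<longrightarrow> m (Suc j) = m j + s)"
  using assms by (auto simp: segment_iff)

text \<open>The condition on the steps is vacuous when the positions differ by at most 1. Hence one
  formula covers the unit entry on the diagonal, the up edges and the ascending edges, and another
  one the loops, the down edges and the descending edges.\<close>

lemma transfer_mat_index:
  fixes R :: "nat \<Rightarrow> int \<Rightarrow> 'k::field ratfun"
  assumes "a \<le> r" "b \<le> r" and y: "y_wt R m (2 * b + 1) \<noteq> 0"
  shows "(1\<^sub>m (r + 1) - transfer_mat R m r) $$ (b, a) =
    fps_const (if a \<le> b \<and> (\<forall>j. Suc a \<le> j \<and> Suc j < Suc b \<longrightarrow> m (Suc j) = m j + 1)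
      then (-1) ^ (b - a) else 0)
    - fps_X * fps_const (if b \<le> a \<and> (\<forall>j. Suc b \<le> j \<and> Suc j < Suc a \<longrightarrow> m (Suc j) = m j + (-1))
      then y_wt R m (2 * b + 1) * (\<Prod>j=Suc b..<Suc a. y_wt R m (2 * j) / y_wt R m (2 * j - 1)) else 0)"
    (is "_ = ?rhs")
proof -
  let ?E = "compact_edge R m r (Suc a) (Suc b)"
  have edge: "?E w \<longleftrightarrow>
    b = a + 1 \<and> w = 1 \<or>
    a = b + 1 \<and> w = fps_X * fps_const (y_wt R m (2 * b + 2)) \<or>
    a = b \<and> w = fps_X * fps_const (y_wt R m (2 * b + 1)) \<or>
    b + 2 \<le> a \<and> segment (-1) r m (Suc b) a \<and>
      w = fps_X * fps_const ((\<Prod>j=Suc b..a. y_wt R m (2 * j)) / (\<Prod>j=Suc (Suc b)..a. y_wt R m (2 * j - 1))) \<or>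
    a + 2 \<le> b \<and> segment 1 r m (Suc a) b \<and> w = (-1) ^ (b - a - 1)" for w
    using compact_edge_iff[of "a + 1" r "b + 1" R m w] assms by simp
  have T: "transfer_mat R m r $$ (b, a) = (if \<exists>w. ?E w then THE w. ?E w else 0)"
    using assms by (auto simp: transfer_mat_def)
  have Tw: "transfer_mat R m r $$ (b, a) = w" if "\<And>v. ?E v \<longleftrightarrow> v = w" for w
    unfolding T that by simp
  have T0: "transfer_mat R m r $$ (b, a) = 0" if "\<And>v. \<not> ?E v"
    unfolding T by (rule if_not_P) (use that in blast)
  have A: "(1\<^sub>m (r + 1) - transfer_mat R m r) $$ (b, a) =
      (if a = b then 1 else 0) - transfer_mat R m r $$ (b, a)"
    using assms by (simp add: transfer_mat_def)
  consider "b = a + 1" | "a = b + 1" | "a = b" | (lower) "a + 2 \<le> b" | (upper) "b + 2 \<le> a"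
    by linarith
  then show ?thesis
  proof cases
    case 1
    have "transfer_mat R m r $$ (b, a) = 1"
      by (rule Tw, unfold edge) (use 1 in auto)
    then show ?thesis
      unfolding A using 1 by (simp flip: fps_const_neg)
  next
    case 2
    have "transfer_mat R m r $$ (b, a) = fps_X * fps_const (y_wt R m (2 * b + 2))"
      by (rule Tw, unfold edge) (use 2 in auto)
    then show ?thesis
      unfolding A using 2 y by simp
  next
    case 3
    have "transfer_mat R m r $$ (b, a) = fps_X * fps_const (y_wt R m (2 * b + 1))"
      by (rule Tw, unfold edge) (use 3 in auto)
    then show ?thesis
      unfolding A using 3 by simp
  next
    case lower
    have seg: "segment 1 r m (Suc a) b \<longleftrightarrow> (\<forall>j. Suc a \<le> j \<and> Suc j < Suc b \<longrightarrow> m (Suc j) = m j + 1)"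
      using lower assms by (intro segment_Suc_iff) auto
    show ?thesis
    proof (cases "segment 1 r m (Suc a) b")
      case True
      have "transfer_mat R m r $$ (b, a) = (-1) ^ (b - a - 1)"
        by (rule Tw, unfold edge) (use True lower in auto)
      moreover have "b - a = Suc (b - a - 1)" using lower by simp
      then have "(-1) ^ (b - a) = - ((-1) ^ (b - a - 1) :: 'k ratfun)"
        by (metis mult_minus1 power_Suc)
      ultimately show ?thesis
        unfolding A using lower True seg
        by (simp flip: fps_const_power fps_const_neg)
    next
      case False
      have "transfer_mat R m r $$ (b, a) = 0"
        by (rule T0, unfold edge) (use False lower in auto)
      then show ?thesis unfolding A using lower False seg by auto
    qed
  next
    case upper
    let ?P = "(\<Prod>j=Suc b..a. y_wt R m (2 * j)) / (\<Prod>j=Suc (Suc b)..a. y_wt R m (2 * j - 1))"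
    have seg: "segment (-1) r m (Suc b) a \<longleftrightarrow> (\<forall>j. Suc b \<le> j \<and> Suc j < Suc a \<longrightarrow> m (Suc j) = m j + (-1))"
      using upper assms by (intro segment_Suc_iff) auto
    \<comment> \<open>The quotients \<open>y_wt R m (2 * j) / y_wt R m (2 * j - 1)\<close> have one
      denominator more than the edge weight, the one for \<open>j = Suc b\<close>; the diagonal
      weight \<open>y_wt R m (2 * b + 1)\<close> cancels it.\<close>
    have split: "(\<Prod>j=Suc b..a. y_wt R m (2 * j - 1)) =
        y_wt R m (2 * b + 1) * (\<Prod>j=Suc (Suc b)..a. y_wt R m (2 * j - 1))"
      using upper by (subst prod.atLeast_Suc_atMost) simp_all
    have P: "y_wt R m (2 * b + 1) * (\<Prod>j=Suc b..<Suc a. y_wt R m (2 * j) / y_wt R m (2 * j - 1)) = ?P"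
      using split upper y
      by (simp add: atLeastLessThanSuc_atLeastAtMost prod_dividef del: prod.op_ivl_Suc)
    show ?thesis
    proof (cases "segment (-1) r m (Suc b) a")
      case True
      have "transfer_mat R m r $$ (b, a) = fps_X * fps_const ?P"
        by (rule Tw, unfold edge) (use True upper in auto)
      then show ?thesis
        unfolding A P using upper True seg by simp
    next
      case False
      have "transfer_mat R m r $$ (b, a) = 0"
        by (rule T0, unfold edge) (use False upper in auto)
      then show ?thesis unfolding A using upper False seg by auto
    qed
  qed
qed

section \<open>The three factors of \<open>P\<close>\<close>

lemma sigma_list: "distinct (sigma r m)" "set (sigma r m) \<subseteq> {1..<r + 1}"
  using flip_list[where s = 1 and r = r and m = m] by (auto simp: sigma_def simp del: upt_Suc)

lemma tau_list: "distinct (tau r m)" "set (tau r m) \<subseteq> {1..<r + 1}"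
  using flip_list[where s = "-1" and r = r and m = m] by (auto simp: tau_def simp del: upt_Suc)

lemma transpose_F_mat:
  "(F_mat m r :: 'k::field ratfun mat)\<^sup>T = upper_prod (r + 1) (\<lambda>_. 1) (rev (sigma r m))"
proof -
  have "(f_mat r i :: 'k ratfun mat)\<^sup>T = upper_elem (r + 1) (\<lambda>_. 1) i" for i
    by (intro eq_matI) (auto simp: f_mat_def upper_elem_def mat_unit_def)
  moreover have "set (map (f_mat r) (sigma r m)) \<subseteq> carrier_mat (r + 1) (r + 1)"
    by (auto simp: f_mat_def mat_unit_def)
  ultimately show ?thesis
    unfolding F_mat_def upper_prod_def by (subst transpose_mat_prod) (simp_all add: rev_map comp_def)
qed

lemma F_mat_carrier: "F_mat m r \<in> carrier_mat (r + 1) (r + 1)"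
  unfolding F_mat_def by (intro mat_prod_carrier) (auto simp: f_mat_def mat_unit_def)

text \<open>All scalars are 1, so the entry only records whether 1, ..., \<open>k\<close> occur in
  this order in the reversed \<sigma>, that is, whether the path has no ascent among these
  indices.\<close>

lemma F_mat_first_col:
  assumes "k \<le> r"
  shows "(F_mat m r :: 'k::field ratfun mat) $$ (k, 0) =
    (if \<forall>j. 1 \<le> j \<and> j < k \<longrightarrow> m (Suc j) \<noteq> m j + 1 then 1 else 0)"
proof -
  have "(F_mat m r :: 'k ratfun mat) $$ (k, 0) = (F_mat m r)\<^sup>T $$ (0, k)"
    using F_mat_carrier[of m r, where 'a = 'k] assms by (subst index_transpose_mat) auto
  also have "\<dots> = (if subseq [Suc 0..<Suc k] (rev (sigma r m)) then 1 else 0)"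
    unfolding transpose_F_mat using assms sigma_list[of r m]
    by (subst upper_prod_index) (auto simp del: upt_Suc)
  also have "subseq [Suc 0..<Suc k] (rev (sigma r m)) \<longleftrightarrow>
      (\<forall>j. Suc 0 \<le> j \<and> Suc j < Suc k \<longrightarrow> m (Suc j) \<noteq> m j + 1)"
    unfolding sigma_def using assms by (intro subseq_rev_flip_iff) auto
  finally show ?thesis by simp
qed

text \<open>Inverting the product reverses the factors and negates the scalars, and transposing
  reverses them once more, so \<open>G\<close> is the transpose of a product in the order of
  \<sigma> itself.\<close>

lemma F_mat_inverse:
  fixes m :: "nat \<Rightarrow> int" and r :: nat
  defines "G \<equiv> (upper_prod (r + 1) (\<lambda>_. -1) (sigma r m) :: 'k::field ratfun mat)\<^sup>T"
  shows "G * F_mat m r = 1\<^sub>m (r + 1)" "F_mat m r * G = 1\<^sub>m (r + 1)"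
proof -
  have G: "G \<in> carrier_mat (r + 1) (r + 1)" by (simp add: G_def)
  have "(G * F_mat m r)\<^sup>T = (F_mat m r)\<^sup>T * G\<^sup>T"
    using G F_mat_carrier by (rule transpose_mult)
  also have "\<dots> = 1\<^sub>m (r + 1)"
    unfolding transpose_F_mat G_def
    using upper_prod_inverse[OF sigma_list(2), of r "\<lambda>_. 1" m] by simp
  finally show *: "G * F_mat m r = 1\<^sub>m (r + 1)"
    by (metis transpose_one transpose_transpose)
  then show "F_mat m r * G = 1\<^sub>m (r + 1)"
    using mat_mult_left_right_inverse[OF G F_mat_carrier] by blast
qed

lemma d_prod_index:
  assumes "a \<le> r" "b \<le> r"
  shows "mat_prod (r + 1) (map (d_mat R m r) [1..<r + 2]) $$ (a, b) =
    (if a = b then y_wt R m (2 * a + 1) else 0)"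
  unfolding d_mat_def
  using assms by (subst diag_prod_index[where c = "\<lambda>i. y_wt R m (2 * i - 1)"]) (auto simp del: upt_Suc)

lemma d_prod_carrier: "mat_prod (r + 1) (map (d_mat R m r) is) \<in> carrier_mat (r + 1) (r + 1)"
  by (intro mat_prod_carrier) (auto simp: d_mat_def mat_unit_def)

lemma e_prod_eq_upper_prod:
  "mat_prod (r + 1) (map (e_mat R m r) is) =
    upper_prod (r + 1) (\<lambda>i. y_wt R m (2 * i) / y_wt R m (2 * i - 1)) is"
  unfolding upper_prod_def by (intro arg_cong[of _ _ "mat_prod _"]) (simp add: upper_elem_def e_mat_def)

text \<open>Separation by powers of t: the identity, the up edges and the ascending edges give the
  inverse of \<open>F\<close>, which is lower triangular; the edges with weight divisible by t give
  the upper triangular product of the diagonal factor and the factor over \<tau>.\<close>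

lemma one_minus_transfer_mat:
  fixes R :: "nat \<Rightarrow> int \<Rightarrow> 'k::field ratfun"
  assumes y: "\<And>a. a \<le> r \<Longrightarrow> y_wt R m (2 * a + 1) \<noteq> 0"
  shows "1\<^sub>m (r + 1) - transfer_mat R m r =
    map_mat fps_const ((upper_prod (r + 1) (\<lambda>_. -1) (sigma r m))\<^sup>T)
    - fps_X \<cdot>\<^sub>m map_mat fps_const (mat_prod (r + 1) (map (d_mat R m r) [1..<r + 2])
        * mat_prod (r + 1) (map (e_mat R m r) (tau r m)))"
    (is "?A = map_mat fps_const ?G - fps_X \<cdot>\<^sub>m map_mat fps_const (?D * ?E)")
proof (rule eq_matI)
  have G: "?G \<in> carrier_mat (r + 1) (r + 1)" by simp
  have E: "?E \<in> carrier_mat (r + 1) (r + 1)" by (simp only: e_prod_eq_upper_prod upper_prod_carrier)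
  have D: "?D \<in> carrier_mat (r + 1) (r + 1)" by (rule d_prod_carrier)
  show dims: "dim_row ?A = dim_row (map_mat fps_const ?G - fps_X \<cdot>\<^sub>m map_mat fps_const (?D * ?E))"
    "dim_col ?A = dim_col (map_mat fps_const ?G - fps_X \<cdot>\<^sub>m map_mat fps_const (?D * ?E))"
    using D E by (auto simp: transfer_mat_def)
  fix b a
  assume "b < dim_row (map_mat fps_const ?G - fps_X \<cdot>\<^sub>m map_mat fps_const (?D * ?E))"
    "a < dim_col (map_mat fps_const ?G - fps_X \<cdot>\<^sub>m map_mat fps_const (?D * ?E))"
  then have ab: "a \<le> r" "b \<le> r" using D E by auto
  have "?G $$ (b, a) = upper_prod (r + 1) (\<lambda>_. -1) (sigma r m) $$ (a, b)"
    using ab by (subst index_transpose_mat) auto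
  also have "\<dots> = (if a \<le> b \<and> subseq [Suc a..<Suc b] (sigma r m) then (-1) ^ (b - a) else 0)"
    using ab sigma_list[of r m] by (subst upper_prod_index) (auto simp del: upt_Suc)
  also have "subseq [Suc a..<Suc b] (sigma r m) \<longleftrightarrow>
      (\<forall>j. Suc a \<le> j \<and> Suc j < Suc b \<longrightarrow> m (Suc j) = m j + 1)"
    unfolding sigma_def using ab by (intro subseq_flip_iff) auto
  finally have Gba: "?G $$ (b, a) =
      (if a \<le> b \<and> (\<forall>j. Suc a \<le> j \<and> Suc j < Suc b \<longrightarrow> m (Suc j) = m j + 1) then (-1) ^ (b - a) else 0)" .
  have "?E $$ (b, a) = (if b \<le> a \<and> subseq [Suc b..<Suc a] (tau r m)
      then \<Prod>j=Suc b..<Suc a. y_wt R m (2 * j) / y_wt R m (2 * j - 1) else 0)"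
    unfolding e_prod_eq_upper_prod using ab tau_list[of r m] by (subst upper_prod_index) (auto simp del: upt_Suc)
  also have "subseq [Suc b..<Suc a] (tau r m) \<longleftrightarrow>
      (\<forall>j. Suc b \<le> j \<and> Suc j < Suc a \<longrightarrow> m (Suc j) = m j + (-1))"
    unfolding tau_def using ab by (intro subseq_flip_iff) auto
  finally have Eba: "?E $$ (b, a) = (if b \<le> a \<and> (\<forall>j. Suc b \<le> j \<and> Suc j < Suc a \<longrightarrow> m (Suc j) = m j + (-1))
      then \<Prod>j=Suc b..<Suc a. y_wt R m (2 * j) / y_wt R m (2 * j - 1) else 0)" .
  have "(?D * ?E) $$ (b, a) = (\<Sum>k<r + 1. ?D $$ (b, k) * ?E $$ (k, a))"
    using ab by (intro mult_mat_index[OF D E]) auto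
  also have "\<dots> = (\<Sum>k<r + 1. if k = b then y_wt R m (2 * b + 1) * ?E $$ (b, a) else 0)"
    using ab by (intro sum.cong refl, subst d_prod_index) auto
  also have "\<dots> = y_wt R m (2 * b + 1) * ?E $$ (b, a)"
    using ab by simp
  finally have DE: "(?D * ?E) $$ (b, a) = y_wt R m (2 * b + 1) * ?E $$ (b, a)" .
  have "(map_mat fps_const ?G - fps_X \<cdot>\<^sub>m map_mat fps_const (?D * ?E)) $$ (b, a)
      = fps_const (?G $$ (b, a)) - fps_X * fps_const ((?D * ?E) $$ (b, a))"
    using ab G D E by simp
  also have "\<dots> = ?A $$ (b, a)"
    unfolding transfer_mat_index[OF ab y[OF ab(2)]] Gba DE Eba
      if_distrib[of "(*) (y_wt R m (2 * b + 1))"] mult_zero_right ..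
  finally show "?A $$ (b, a) = (map_mat fps_const ?G - fps_X \<cdot>\<^sub>m map_mat fps_const (?D * ?E)) $$ (b, a)" ..
qed

lemma map_mat_fps_const_mult:
  fixes M N :: "'a::comm_ring_1 mat"
  assumes "M \<in> carrier_mat n n" "N \<in> carrier_mat n n"
  shows "map_mat fps_const (M * N) = map_mat fps_const M * map_mat fps_const N"
proof -
  interpret comm_ring_hom "fps_const :: 'a \<Rightarrow> 'a fps" by unfold_locales auto
  show ?thesis using assms by (rule mat_hom_mult)
qed

lemma map_mat_fps_const_one: "map_mat fps_const (1\<^sub>m n) = 1\<^sub>m n"
  by (intro eq_matI) auto

text \<open>The first ascending step starts at \<open>a\<^sub>1\<close>: an earlier one would extend
  to a maximal ascending segment starting further left.\<close>

lemma no_ascent_below_iff_le_first_max_asc: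
  assumes "first_max_asc r m a\<^sub>1 a\<^sub>2" "k \<le> r"
  shows "(\<forall>j. 1 \<le> j \<and> j < k \<longrightarrow> m (Suc j) \<noteq> m j + 1) \<longleftrightarrow> k \<le> a\<^sub>1"
proof -
  have seg: "segment 1 r m a\<^sub>1 a\<^sub>2" using assms(1) by (auto simp: first_max_asc_def max_segment_def)
  then have asc: "m (Suc a\<^sub>1) = m a\<^sub>1 + 1" "1 \<le> a\<^sub>1" by (auto simp: segment_iff)
  have "m (Suc j) \<noteq> m j + 1" if "1 \<le> j" "j < a\<^sub>1" for j
  proof
    assume "m (Suc j) = m j + 1"
    then have "segment 1 r m j (Suc j)" using that seg by (auto simp: segment_iff)
    then obtain \<alpha> \<beta> where "max_asc r m \<alpha> \<beta>" "\<alpha> \<le> j" using segment_extend by blast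
    then show False using assms(1) that unfolding first_max_asc_def by fastforce
  qed
  then show ?thesis using asc by (meson le_less_trans linorder_not_le less_le_trans)
qed

text \<open>Any ascent lies in a maximal ascending segment, and among the left ends of these
  segments there is a least one.\<close>

lemma no_ascent_if_no_first_max_asc:
  assumes "\<nexists>a\<^sub>1 a\<^sub>2. first_max_asc r m a\<^sub>1 a\<^sub>2" "1 \<le> j" "j < r"
  shows "m (Suc j) \<noteq> m j + 1"
proof
  assume "m (Suc j) = m j + 1"
  then have "segment 1 r m j (Suc j)" using assms by (auto simp: segment_iff)
  then have "\<exists>\<alpha>. \<exists>\<beta>. max_asc r m \<alpha> \<beta>" using segment_extend by blast
  then obtain \<alpha> where "\<exists>\<beta>. max_asc r m \<alpha> \<beta>" "\<And>\<alpha>' \<beta>. max_asc r m \<alpha>' \<beta> \<Longrightarrow> \<alpha> \<le> \<alpha>'"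
    using exists_least_iff[of "\<lambda>\<alpha>. \<exists>\<beta>. max_asc r m \<alpha> \<beta>"] by (meson linorder_not_le)
  then show False using assms(1) unfolding first_max_asc_def by blast
qed

theorem theorem7p1:
  fixes R :: "nat \<Rightarrow> int \<Rightarrow> 'k::field_char_0 ratfun" and m :: "nat \<Rightarrow> int" and r :: nat
  assumes "1 \<le> r" and "Q_system r R" and "motzkin_path r m"
  defines "A \<equiv> 1\<^sub>m (r + 1) - transfer_mat R m r"
    and "B \<equiv> 1\<^sub>m (r + 1) - fps_X \<cdot>\<^sub>m map_mat fps_const (P_mat R m r)"
    and "F \<equiv> map_mat fps_const (F_mat m r)"
  shows "invertible_mat A \<and> invertible_mat B
    \<and> mat_inv A = mat_inv B * F
    \<and> (\<forall>a\<^sub>1 a\<^sub>2. first_max_asc r m a\<^sub>1 a\<^sub>2 \<longrightarrow>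
         entry (mat_inv A) 1 1 =
           (if a\<^sub>1 = 1 then entry (mat_inv B) 1 1 + entry (mat_inv B) 1 2
            else \<Sum>a=1..a\<^sub>1 + 1. entry (mat_inv B) 1 a))
    \<and> ((\<nexists>a\<^sub>1 a\<^sub>2. first_max_asc r m a\<^sub>1 a\<^sub>2) \<longrightarrow>
         entry (mat_inv A) 1 1 = (\<Sum>a=1..r + 1. entry (mat_inv B) 1 a))"
proof -
  let ?n = "r + 1"
  let ?D = "mat_prod ?n (map (d_mat R m r) [1..<r + 2])"
  let ?E = "mat_prod ?n (map (e_mat R m r) (tau r m))"
  let ?N = "(upper_prod ?n (\<lambda>_. -1) (sigma r m) :: 'k ratfun mat)\<^sup>T"
  let ?G = "map_mat fps_const ?N"
  have y: "y_wt R m (2 * a + 1) \<noteq> 0" if "a \<le> r" for a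
    using y_odd_nonzero[OF assms(2), of "a + 1" m] that by (simp add: y_wt_def)
  have D: "?D \<in> carrier_mat ?n ?n" by (rule d_prod_carrier)
  have E: "?E \<in> carrier_mat ?n ?n" by (simp only: e_prod_eq_upper_prod upper_prod_carrier)
  have DE: "?D * ?E \<in> carrier_mat ?n ?n" using D E by (rule mult_carrier_mat)
  have N: "?N \<in> carrier_mat ?n ?n" by simp
  have G: "?G \<in> carrier_mat ?n ?n" by simp
  have Fm: "(F_mat m r :: 'k ratfun mat) \<in> carrier_mat ?n ?n" by (rule F_mat_carrier)
  have F: "F \<in> carrier_mat ?n ?n" using Fm by (simp add: F_def)
  have P: "P_mat R m r = F_mat m r * (?D * ?E)"
    unfolding P_mat_def using Fm D E by (rule assoc_mult_mat)
  have A: "A \<in> carrier_mat ?n ?n" 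
    unfolding A_def by (intro minus_carrier_mat) (simp add: transfer_mat_def)
  have B: "B \<in> carrier_mat ?n ?n"
    using mult_carrier_mat[OF Fm DE] unfolding B_def P
    by (intro minus_carrier_mat smult_carrier_mat map_carrier_mat[THEN iffD2])
  have FG: "F * ?G = 1\<^sub>m ?n" and GF: "?G * F = 1\<^sub>m ?n"
    unfolding F_def map_mat_fps_const_mult[OF Fm N, symmetric] map_mat_fps_const_mult[OF N Fm, symmetric]
    by (simp_all only: F_mat_inverse map_mat_fps_const_one)
  have "A = ?G - fps_X \<cdot>\<^sub>m map_mat fps_const (?D * ?E)"
    unfolding A_def by (rule one_minus_transfer_mat[OF y])
  \<comment> \<open>Left multiplication by \<open>F\<close> turns its inverse into the identity and
    \<open>?D * ?E\<close> into \<open>P_mat R m r\<close>, so the result is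
    \<open>B\<close>.\<close>
  then have "F * A = F * ?G - F * (fps_X \<cdot>\<^sub>m map_mat fps_const (?D * ?E))"
    using F G DE by (simp only:) (intro mult_minus_distrib_mat, auto)
  also have "F * (fps_X \<cdot>\<^sub>m map_mat fps_const (?D * ?E)) = fps_X \<cdot>\<^sub>m (F * map_mat fps_const (?D * ?E))"
    using F DE by (intro mult_smult_distrib) auto
  also have "F * map_mat fps_const (?D * ?E) = map_mat fps_const (P_mat R m r)"
    unfolding P F_def by (rule map_mat_fps_const_mult[OF Fm DE, symmetric])
  finally have FA: "F * A = B" by (simp only: FG B_def)
  have GB: "?G * B = A"
    unfolding FA[symmetric] using assoc_mult_mat[OF G F A] A by (simp only: GF left_mult_one_mat)
  have "P_mat R m r \<in> carrier_mat ?n ?n" unfolding P using Fm DE by (rule mult_carrier_mat)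
  from one_minus_fps_X_mat_inverse[OF this]
  obtain C where C: "C \<in> carrier_mat ?n ?n" "B * C = 1\<^sub>m ?n" "C * B = 1\<^sub>m ?n"
    unfolding B_def by blast
  have CF: "C * F \<in> carrier_mat ?n ?n" using C(1) F by (rule mult_carrier_mat)
  \<comment> \<open>With \<open>A\<close> written as \<open>?G * B\<close>, the inner product
    \<open>B * C\<close> is the identity, and \<open>?G * F\<close> remains.\<close>
  have "A * (C * F) = ?G * (B * C) * F"
    unfolding GB[symmetric] using G B C(1) F by (simp add: assoc_mult_mat[of _ ?n ?n _ ?n _ ?n] mult_carrier_mat[of _ ?n ?n])
  then have ACF: "A * (C * F) = 1\<^sub>m ?n" using C G GF by simp
  have CFA: "C * F * A = 1\<^sub>m ?n" using assoc_mult_mat[OF C(1) F A] FA C by simp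
  have invA: "mat_inv A = C * F" "invertible_mat A"
    using mat_inv_eqI[OF A CF ACF CFA] by auto
  have invB: "mat_inv B = C" "invertible_mat B"
    using mat_inv_eqI[OF B C] by auto
  \<comment> \<open>Both formulas at once: \<open>c\<close> is the last position, counted from 0, of
    a one in the first column of \<open>F\<close>. It is \<open>a\<^sub>1\<close> if there is an
    ascending segment and \<open>r\<close> otherwise.\<close>
  have entry: "entry (mat_inv A) 1 1 = (\<Sum>a\<in>{1..c + 1}. entry (mat_inv B) 1 a)"
    if "c \<le> r" and c: "\<And>k. k \<le> r \<Longrightarrow> (\<forall>j. 1 \<le> j \<and> j < k \<longrightarrow> m (Suc j) \<noteq> m j + 1) \<longleftrightarrow> k \<le> c" for c
  proof -
    have "entry (mat_inv A) 1 1 = (\<Sum>k<?n. C $$ (0, k) * F $$ (k, 0))"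
      unfolding entry_def invA using mult_mat_index[OF C(1) F] by simp
    also have "\<dots> = (\<Sum>k<?n. if k \<le> c then C $$ (0, k) else 0)"
    proof (intro sum.cong refl)
      fix k assume "k \<in> {..<?n}"
      then show "C $$ (0, k) * F $$ (k, 0) = (if k \<le> c then C $$ (0, k) else 0)"
        using c[of k] F_mat_first_col[of k r m, where 'k = 'k] Fm by (auto simp: F_def)
    qed
    also have "\<dots> = (\<Sum>k\<in>{0..c}. C $$ (0, k))"
      using that(1) by (intro sum.mono_neutral_cong_right) auto
    also have "\<dots> = (\<Sum>a\<in>{1..c + 1}. entry (mat_inv B) 1 a)"
      unfolding entry_def invB by (rule sum.reindex_bij_witness[of _ "\<lambda>a. a - 1" "\<lambda>k. k + 1"]) auto
    finally show ?thesis .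
  qed
  show ?thesis
  proof (intro conjI allI impI)
    fix a\<^sub>1 a\<^sub>2 assume first: "first_max_asc r m a\<^sub>1 a\<^sub>2"
    then have "a\<^sub>1 \<le> r" by (auto simp: first_max_asc_def max_segment_def segment_def)
    from entry[OF this no_ascent_below_iff_le_first_max_asc[OF first]]
    have "entry (mat_inv A) 1 1 = (\<Sum>a=1..a\<^sub>1 + 1. entry (mat_inv B) 1 a)" .
    \<comment> \<open>For \<open>a\<^sub>1 = 1\<close> the general sum runs over 1 and 2, so the
      first case is an instance of the second.\<close>
    then show "entry (mat_inv A) 1 1 =
        (if a\<^sub>1 = 1 then entry (mat_inv B) 1 1 + entry (mat_inv B) 1 2
         else \<Sum>a=1..a\<^sub>1 + 1. entry (mat_inv B) 1 a)"
      by (simp add: numeral_2_eq_2)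
  next
    assume "\<nexists>a\<^sub>1 a\<^sub>2. first_max_asc r m a\<^sub>1 a\<^sub>2"
    then show "entry (mat_inv A) 1 1 = (\<Sum>a=1..r + 1. entry (mat_inv B) 1 a)"
      using no_ascent_if_no_first_max_asc by (intro entry) auto
  qed (use invA invB in auto)
qed

end
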